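(* Let $I\subset(0,\infty)$ be an interval, let $f:I\to\mathbb{R}$ be a differentiable function on the interior $I^\circ$, let $a,b\in I$ with $a<b$, and let $f'\in L[a,b]$. Let $\alpha>0$, $s\in(0,1]$, $q>1$ and $\frac1p+\frac1q=1$. If $|f'|^q$ is harmonically $s$-convex on $[a,b]$, then for all $x\in[a,b]$, $$|S_f(g;\alpha;x,a,b)|\le\frac{(x-a)^{\alpha+1}}{(ax)^{\alpha-1}}\big(\lambda_1(a,x,0,p,\alpha p)\big)^{\frac1p}\left(\frac{|f'(x)|^q+|f'(a)|^q}{s+1}\right)^{\frac1q}+\frac{(b-x)^{\alpha+1}}{(bx)^{\alpha-1}}\big(\lambda_3(b,x,0,p,\alpha p)\big)^{\frac1p}\left(\frac{|f'(x)|^q+|f'(b)|^q}{s+1}\right)^{\frac1q}.$$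
   Context: A function $h:K\to\mathbb{R}$ on an interval $K\subset(0,\infty)$ is harmonically $s$-convex ($s\in(0,1]$ fixed) if $h\left(\frac{uv}{tu+(1-t)v}\right)\le t^s h(v)+(1-t)^s h(u)$ for all $u,v\in K$, $t\in[0,1]$. With $g(u)=1/u$, $$S_f(g;\alpha;x,a,b)=\left[\left(\frac{x-a}{ax}\right)^{\alpha}+\left(\frac{b-x}{bx}\right)^{\alpha}\right]f(x)-\Gamma(\alpha+1)\left\{J_{1/x-}^{\alpha}(f\circ g)(1/b)+J_{1/x+}^{\alpha}(f\circ g)(1/a)\right\},$$ where $\Gamma$ is the Gamma function and the Riemann–Liouville fractional integrals are $J_{c+}^{\alpha}h(y)=\frac{1}{\Gamma(\alpha)}\int_c^y(y-t)^{\alpha-1}h(t)\,dt$ ($y>c$) and $J_{d-}^{\alpha}h(y)=\frac{1}{\Gamma(\alpha)}\int_y^d(t-y)^{\alpha-1}h(t)\,dt$ ($y<d$); an integral over a degenerate interval (when $x=a$ or $x=b$) is $0$. Beta function: $\beta(u,v)=\int_0^1t^{u-1}(1-t)^{v-1}dt$ for $u,v>0$. Hypergeometric function: ${}_2F_1(A,B;C;z)=\frac{1}{\beta(B,C-B)}\int_0^1t^{B-1}(1-t)^{C-B-1}(1-zt)^{-A}dt$ for $C>B>0$, $|z|<1$. Define, for a parameter $\sigma\ge0$ (used here with $\sigma=0$), $$\lambda_1(a,x,\sigma,\vartheta,\rho)=\frac{\beta(\rho+\sigma+1,1)}{x^{2\vartheta}}\,{}_2F_1\!\left(2\vartheta,\rho+\sigma+1;\rho+\sigma+2;1-\tfrac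 ax\right),$$ $$\lambda_3(b,x,\sigma,\vartheta,\rho)=\frac{\beta(1,\rho+\sigma+1)}{b^{2\vartheta}}\,{}_2F_1\!\left(2\vartheta,1;\rho+\sigma+2;1-\tfrac xb\right).$$ $L[a,b]$ denotes the integrable functions on $[a,b]$. The derivative $f'$ is regarded as a function on $[a,b]$; if $a$ or $b$ is an endpoint of $I$, $f'$ there is the one-sided derivative. *)

theory Defs
  imports "HOL-Analysis.Analysis"
begin

definition harm_s_convex_on :: "real \<Rightarrow> real set \<Rightarrow> (real \<Rightarrow> real) \<Rightarrow> bool" where
  "harm_s_convex_on s K h \<longleftrightarrow>
     is_interval K \<and> K \<subseteq> {0<..} \<and>
     (\<forall>u\<in>K. \<forall>v\<in>K. \<forall>t\<in>{0..1}.
        h (u * v / (t * u + (1 - t) * v)) \<le> t powr s * h v + (1 - t) powr s * h u)"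

text \<open>The fractional integrals are Lebesgue integrals over closed intervals. The value
  \<open>0 powr r = 0\<close> at the singular endpoint does not matter, being attained on a null set, and
  for \<open>y = c\<close> or \<open>y = d\<close> the integral is 0.\<close>

definition RL_plus :: "real \<Rightarrow> real \<Rightarrow> (real \<Rightarrow> real) \<Rightarrow> real \<Rightarrow> real" where
  "RL_plus c \<alpha> h y =
     1 / Gamma \<alpha> * (LINT t:{c..y}|lebesgue. (y - t) powr (\<alpha> - 1) * h t)"

definition RL_minus :: "real \<Rightarrow> real \<Rightarrow> (real \<Rightarrow> real) \<Rightarrow> real \<Rightarrow> real" where
  "RL_minus d \<alpha> h y =
     1 / Gamma \<alpha> * (LINT t:{y..d}|lebesgue. (t - y) powr (\<alpha> - 1) * h t)"

definition ostrowski_S ::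
  "(real \<Rightarrow> real) \<Rightarrow> (real \<Rightarrow> real) \<Rightarrow> real \<Rightarrow> real \<Rightarrow> real \<Rightarrow> real \<Rightarrow> real" where
  "ostrowski_S f g \<alpha> x a b =
     (((x - a) / (a * x)) powr \<alpha> + ((b - x) / (b * x)) powr \<alpha>) * f x
     - Gamma (\<alpha> + 1) * (RL_minus (1 / x) \<alpha> (f \<circ> g) (1 / b) + RL_plus (1 / x) \<alpha> (f \<circ> g) (1 / a))"

text \<open>Euler's integral for the Gauss hypergeometric function, meaningful for \<open>C > B > 0\<close> and
  \<open>\<bar>z\<bar> < 1\<close>. The constant \<open>Beta\<close> is defined in the library through \<open>Gamma\<close>; it equals the
  Euler integral by \<open>has_integral_Beta_real\<close>.\<close>

definition hyp2F1 :: "real \<Rightarrow> real \<Rightarrow> real \<Rightarrow> real \<Rightarrow> real" where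
  "hyp2F1 A B C z =
     1 / Beta B (C - B) *
       (LINT t:{0..1}|lebesgue.
          t powr (B - 1) * (1 - t) powr (C - B - 1) * (1 - z * t) powr (- A))"

definition lambda1 :: "real \<Rightarrow> real \<Rightarrow> real \<Rightarrow> real \<Rightarrow> real \<Rightarrow> real" where
  "lambda1 a x \<sigma> \<theta> \<rho> =
     Beta (\<rho> + \<sigma> + 1) 1 / x powr (2 * \<theta>) *
       hyp2F1 (2 * \<theta>) (\<rho> + \<sigma> + 1) (\<rho> + \<sigma> + 2) (1 - a / x)"

definition lambda3 :: "real \<Rightarrow> real \<Rightarrow> real \<Rightarrow> real \<Rightarrow> real \<Rightarrow> real" where
  "lambda3 b x \<sigma> \<theta> \<rho> =
     Beta 1 (\<rho> + \<sigma> + 1) / b powr (2 * \<theta>) *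
       hyp2F1 (2 * \<theta>) 1 (\<rho> + \<sigma> + 2) (1 - x / b)"

end

theory Submission
  imports Defs
begin

text \<open>For an endpoint \<open>c\<close> of \<open>[a, b]\<close>, the path \<open>y(t) = c x / (t c + (1 - t) x)\<close> runs from \<open>c\<close> to \<open>x\<close>, and
  \<open>1 / y(t)\<close> is affine in \<open>t\<close>. In the variable \<open>t\<close> the fractional integral becomes
  \<open>\<integral> t\<^sup>\<alpha>\<^sup>-\<^sup>1 f(y(t)) dt\<close>, and integrating \<open>(t\<^sup>\<alpha> f(y(t)))'\<close> over \<open>[0, 1]\<close> expresses each half of
  \<open>S\<^sub>f\<close> through \<open>\<integral> t\<^sup>\<alpha> f'(y(t)) y'(t) dt\<close>. Hoelder's inequality separates the factor
  \<open>t\<^sup>\<alpha> (t c + (1 - t) x)\<^sup>-\<^sup>2\<close>, whose \<open>p\<close>-th power integrates to \<open>\<lambda>\<^sub>1\<close> or \<open>\<lambda>\<^sub>3\<close>, from \<open>f'(y(t))\<close>,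
  whose \<open>q\<close>-th power is at most \<open>t\<^sup>s |f'(x)|\<^sup>q + (1 - t)\<^sup>s |f'(c)|\<^sup>q\<close> by convexity.\<close>

section \<open>Hoelder's inequality with a majorant\<close>

text \<open>Only the majorant \<open>w\<close> of \<open>v powr q\<close> has to be integrable, and \<open>F\<close> only in the sense of
  Henstock and Kurzweil; the derivative \<open>f'\<close> then never needs to be shown measurable along \<open>y\<close>.\<close>

lemma Holder_integral_bound:
  fixes F u v w :: "'n::euclidean_space \<Rightarrow> real"
  assumes pq: "p > 1" "q > 1" "1 / p + 1 / q = 1"
    and F: "F integrable_on S"
    and u: "(\<lambda>t. u t powr p) integrable_on S" "\<And>t. t \<in> S \<Longrightarrow> 0 \<le> u t"
    and v: "w integrable_on S" "\<And>t. t \<in> S \<Longrightarrow> 0 \<le> v t" "\<And>t. t \<in> S \<Longrightarrow> v t powr q \<le> w t"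
    and le: "\<And>t. t \<in> S \<Longrightarrow> \<bar>F t\<bar> \<le> u t * v t"
  shows "\<bar>integral S F\<bar> \<le> integral S (\<lambda>t. u t powr p) powr (1 / p) * integral S w powr (1 / q)"
proof -
  define A where "A = integral S (\<lambda>t. u t powr p)"
  define B where "B = integral S w"
  have A0: "A \<ge> 0" unfolding A_def by (rule integral_nonneg[OF u(1)]) simp
  have B0: "B \<ge> 0" unfolding B_def
    by (rule integral_nonneg[OF v(1)]) (meson order_trans powr_ge_zero v(3))
  \<comment> \<open>The shift by \<open>e\<close> makes both normalizing factors positive, also when \<open>A = 0\<close> or \<open>B = 0\<close>.\<close>
  have perturbed: "\<bar>integral S F\<bar> \<le> (A + e) powr (1 / p) * (B + e) powr (1 / q)" if e: "e > 0" for e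
  proof -
    define A' B' where "A' = A + e" and "B' = B + e"
    have pos: "A' > 0" "B' > 0" using A0 B0 e by (auto simp: A'_def B'_def)
    \<comment> \<open>\<open>k\<close> undoes the normalization of \<open>u\<close> and
      \<open>v\<close> in Young's inequality. Since \<open>A \<le> A'\<close> and
      \<open>B \<le> B'\<close>, integrating the normalized bound gives at most
      \<open>1 / p + 1 / q = 1\<close>, so \<open>k\<close> itself bounds the integral.\<close>
    define k where "k = A' powr (1 / p) * B' powr (1 / q)"
    have k: "k > 0" using pos by (simp add: k_def)
    have pt: "\<bar>F t\<bar> \<le> k * (u t powr p / (p * A') + w t / (q * B'))" if t: "t \<in> S" for t
    proof -
      have "u t / A' powr (1 / p) * (v t / B' powr (1 / q))
          \<le> (u t / A' powr (1 / p)) powr p / p + (v t / B' powr (1 / q)) powr q / q"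
        using pq u(2)[OF t] v(2)[OF t] by (intro Youngs_inequality) auto
      also have "\<dots> = u t powr p / (p * A') + v t powr q / (q * B')"
        using pq u(2)[OF t] v(2)[OF t] pos by (simp add: powr_divide powr_powr mult.commute)
      also have "\<dots> \<le> u t powr p / (p * A') + w t / (q * B')"
        using v(3)[OF t] pos pq by (intro add_left_mono divide_right_mono) auto
      finally have "k * (u t / A' powr (1 / p) * (v t / B' powr (1 / q)))
          \<le> k * (u t powr p / (p * A') + w t / (q * B'))"
        using k by (intro mult_left_mono) auto
      moreover have "k * (u t / A' powr (1 / p) * (v t / B' powr (1 / q))) = u t * v t"
        using pos by (simp add: k_def)
      ultimately show ?thesis using le[OF t] by linarith
    qed
    have I: "((\<lambda>t. k * (u t powr p / (p * A') + w t / (q * B')))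
        has_integral (k * (A / (p * A') + B / (q * B')))) S"
      unfolding A_def B_def
      by (intro has_integral_mult_right has_integral_add has_integral_divide integrable_integral u v)
    have "\<bar>integral S F\<bar> \<le> integral S (\<lambda>t. k * (u t powr p / (p * A') + w t / (q * B')))"
      using integral_norm_bound_integral[OF F has_integral_integrable[OF I]] pt by simp
    also have "\<dots> = k * (A / (p * A') + B / (q * B'))" using I by (rule integral_unique)
    also have "\<dots> \<le> k * (A' / (p * A') + B' / (q * B'))"
      using k pos pq e by (intro mult_left_mono add_mono divide_right_mono) (auto simp: A'_def B'_def)
    also have "\<dots> = k * (1 / p + 1 / q)" using pos by simp
    finally show ?thesis using pq by (simp add: k_def A'_def B'_def)
  qed
  \<comment> \<open>Letting \<open>e\<close> tend to 0 removes the shift. A base tending to 0 is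
    harmless because the exponents are positive and the bases stay nonnegative.\<close>
  have "((\<lambda>e. (A + e) powr (1 / p) * (B + e) powr (1 / q))
      \<longlongrightarrow> (A + 0) powr (1 / p) * (B + 0) powr (1 / q)) (at_right 0)"
    using A0 B0 pq
    by (intro tendsto_intros tendsto_powr') (auto simp: eventually_at_right_less
        intro!: always_eventually eventually_mono[OF eventually_at_right_less])
  then have "\<bar>integral S F\<bar> \<le> (A + 0) powr (1 / p) * (B + 0) powr (1 / q)"
    by (rule tendsto_lowerbound)
      (auto intro!: perturbed eventually_mono[OF eventually_at_right_less])
  then show ?thesis by (simp add: A_def B_def)
qed

section \<open>Reflection and power weights on the unit interval\<close>

text \<open>Needed twice: to reverse the Euler integral in \<open>lambda3\<close>, and to integrate
  \<open>(1 - t) powr s\<close> in the convexity bound.\<close>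

lemma absolutely_integrable_integral_reflect_unit:
  fixes G :: "real \<Rightarrow> real"
  assumes "G absolutely_integrable_on {0..1}"
  shows "(\<lambda>t. G (1 - t)) absolutely_integrable_on {0..1}"
    and "integral {0..1} (\<lambda>t. G (1 - t)) = integral {0..1} G"
proof -
  have img: "(\<lambda>t. 1 - t) ` {0..1::real} = {0..1}"
    by (auto intro!: image_eqI[of _ _ "1 - _"])
  have "((\<lambda>t. 1 - t) has_field_derivative -1) (at t within {0..1::real})" for t
    by (auto intro!: derivative_eq_intros)
  from has_absolute_integral_change_of_variables_1'[OF _ this, of G "integral {0..1} G"]
  have "(\<lambda>t. G (1 - t)) absolutely_integrable_on {0..1}
      \<and> integral {0..1} (\<lambda>t. G (1 - t)) = integral {0..1} G"
    using assms unfolding img by (simp add: inj_on_def)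
  then show "(\<lambda>t. G (1 - t)) absolutely_integrable_on {0..1}"
    and "integral {0..1} (\<lambda>t. G (1 - t)) = integral {0..1} G" by auto
qed

text \<open>The weight may be unbounded at 0 but is integrable for \<open>r > -1\<close>;
  \<open>h\<close> is measurable and bounded, being continuous on a compact set.\<close>

lemma absolutely_integrable_powr_mult_continuous:
  fixes h :: "real \<Rightarrow> real"
  assumes "r > -1" "continuous_on {0..1} h"
  shows "(\<lambda>t. t powr r * h t) absolutely_integrable_on {0..1}"
proof -
  have "(\<lambda>t. t powr r) absolutely_integrable_on {0..1::real}"
    using has_integral_powr_from_0[OF assms(1), of 1]
    by (intro nonnegative_absolutely_integrable_1) (auto simp: integrable_on_def)
  then have "(\<lambda>t. h t * t powr r) absolutely_integrable_on {0..1}"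
    using assms(2)
    by (intro absolutely_integrable_bounded_measurable_product_real
        continuous_imp_measurable_on_sets_lebesgue compact_imp_bounded
        compact_continuous_image) auto
  then show ?thesis by (simp add: mult.commute)
qed

lemma convex_combination_pos:
  fixes c x t :: real
  assumes "0 < c" "0 < x" "t \<in> {0..1}"
  shows "0 < t * c + (1 - t) * x"
  using assms by (cases "t = 0") (auto intro: add_pos_nonneg)

lemma absolutely_integrable_powr_mult_affine_powr:
  fixes c x :: real
  assumes "0 < c" "0 < x" "r > -1"
  shows "(\<lambda>t. t powr r * (t * c + (1 - t) * x) powr v) absolutely_integrable_on {0..1}"
proof (intro absolutely_integrable_powr_mult_continuous continuous_on_powr')
  show "\<forall>t\<in>{0..1}. 0 \<le> t * c + (1 - t) * x \<and> (t * c + (1 - t) * x = 0 \<longrightarrow> 0 < v)"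
    using convex_combination_pos[OF assms(1,2)] by (metis less_le)
qed (use assms(3) in \<open>auto intro!: continuous_intros\<close>)

section \<open>Fractional integrals over the unit interval\<close>

text \<open>The affine map \<open>g\<close> starts at \<open>e\<close>, where the kernel may be
  singular, and ends at \<open>d\<close>. Its Jacobian \<open>\<bar>d - e\<bar>\<close> and the
  kernel together yield \<open>\<bar>d - e\<bar> powr \<alpha>\<close>. Segments and absolute values
  let one statement serve both the left and the right integral.\<close>

lemma RL_kernel_integral:
  fixes h :: "real \<Rightarrow> real"
  assumes "d \<noteq> e" "\<alpha> > 0" and h: "continuous_on (closed_segment d e) h"
  shows "(LINT t:closed_segment d e|lebesgue. \<bar>e - t\<bar> powr (\<alpha> - 1) * h t)
      = \<bar>d - e\<bar> powr \<alpha> * integral {0..1} (\<lambda>t. t powr (\<alpha> - 1) * h (e + t * (d - e)))"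
proof -
  define g where "g t = e + t * (d - e)" for t
  have img: "g ` {0..1} = closed_segment d e"
    by (subst closed_segment_commute, unfold closed_segment_image_interval, intro image_cong) (auto simp: g_def algebra_simps)
  have "continuous_on {0..1} (\<lambda>t. h (g t))"
    using img by (intro continuous_on_compose2[OF h]) (auto simp: g_def intro!: continuous_intros)
  then have AI: "(\<lambda>t. \<bar>d - e\<bar> powr \<alpha> * (t powr (\<alpha> - 1) * h (g t))) absolutely_integrable_on {0..1}"
    using assms(2) by (intro set_integrable_mult_right
        absolutely_integrable_powr_mult_continuous) auto
  have eq: "\<bar>d - e\<bar> * (\<bar>e - g t\<bar> powr (\<alpha> - 1) * h (g t))
      = \<bar>d - e\<bar> powr \<alpha> * (t powr (\<alpha> - 1) * h (g t))" if "t \<in> {0..1}" for t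
  proof -
    have "\<bar>e - g t\<bar> = t * \<bar>d - e\<bar>" using that by (simp add: g_def abs_mult)
    moreover have "\<bar>d - e\<bar> * \<bar>d - e\<bar> powr (\<alpha> - 1) = \<bar>d - e\<bar> powr \<alpha>"
      using assms(1) powr_mult_base[of "\<bar>d - e\<bar>" "\<alpha> - 1"] by simp
    ultimately show ?thesis using that by (simp add: powr_mult mult_ac)
  qed
  have AI': "(\<lambda>t. \<bar>d - e\<bar> * (\<bar>e - g t\<bar> powr (\<alpha> - 1) * h (g t))) absolutely_integrable_on {0..1}"
    \<comment> \<open>A spike over the empty set acts as a congruence: the integrands agree on all
      of \<open>{0..1}\<close>.\<close>
    using AI by (rule absolutely_integrable_spike[of _ _ "{}"]) (simp_all only: eq negligible_empty Diff_empty)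
  have int: "integral {0..1} (\<lambda>t. \<bar>d - e\<bar> * (\<bar>e - g t\<bar> powr (\<alpha> - 1) * h (g t)))
      = \<bar>d - e\<bar> powr \<alpha> * integral {0..1} (\<lambda>t. t powr (\<alpha> - 1) * h (g t))"
    by (subst integral_mult_right[symmetric], intro integral_cong eq)
  have der: "(g has_field_derivative (d - e)) (at t within {0..1})" for t
    unfolding g_def by (auto intro!: derivative_eq_intros)
  have inj: "inj_on g {0..1}" using assms(1) by (auto simp: g_def inj_on_def)
  have "(\<lambda>t. \<bar>e - t\<bar> powr (\<alpha> - 1) * h t) absolutely_integrable_on (closed_segment d e)
      \<and> integral (closed_segment d e) (\<lambda>t. \<bar>e - t\<bar> powr (\<alpha> - 1) * h t)
        = \<bar>d - e\<bar> powr \<alpha> * integral {0..1} (\<lambda>t. t powr (\<alpha> - 1) * h (g t))"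
    using has_absolute_integral_change_of_variables_1'[OF _ der inj,
        of "\<lambda>t. \<bar>e - t\<bar> powr (\<alpha> - 1) * h t"] AI' int unfolding img by auto
  then show ?thesis by (simp add: set_lebesgue_integral_eq_integral g_def)
qed

section \<open>Euler integrals for \<lambda>1 and \<lambda>3\<close>

text \<open>Here \<open>C - B = 1\<close>, so the weight at \<open>t = 1\<close> has exponent 0. The
  Beta prefactor cancels the normalization in \<open>hyp2F1\<close>, and
  \<open>1 - (1 - a / x) * t = D t / x\<close> cancels the power of \<open>x\<close>.\<close>

lemma lambda1_eq_integral:
  assumes "0 < a" "0 < x" "\<rho> > 0"
  shows "lambda1 a x 0 \<theta> \<rho> = integral {0..1} (\<lambda>t. t powr \<rho> * (t * a + (1 - t) * x) powr (- 2 * \<theta>))"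
proof -
  define D where "D t = t * a + (1 - t) * x" for t
  have D: "D t > 0" if "t \<in> {0..1}" for t
    unfolding D_def using assms(1,2) that by (rule convex_combination_pos)
  have scale: "(1 - (1 - a / x) * t) powr (- (2 * \<theta>)) = x powr (2 * \<theta>) * D t powr (- 2 * \<theta>)"
    if "t \<in> {0..1}" for t
  proof -
    have "1 - (1 - a / x) * t = D t / x" using assms by (simp add: D_def field_simps)
    then show ?thesis using D[OF that] assms by (simp add: powr_divide powr_minus_divide)
  qed
  have "(\<lambda>t. t powr \<rho> * D t powr (- 2 * \<theta>)) absolutely_integrable_on {0..1}"
    unfolding D_def using assms by (intro absolutely_integrable_powr_mult_affine_powr) auto
  then have AI: "(\<lambda>t. x powr (2 * \<theta>) * (t powr \<rho> * D t powr (- 2 * \<theta>))) absolutely_integrable_on {0..1}"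
    by (intro set_integrable_mult_right)
  \<comment> \<open>At \<open>t = 1\<close> the library value \<open>0 powr 0 = 0\<close> breaks the equation.\<close>
  have eq: "t powr \<rho> * (1 - t) powr 0 * (1 - (1 - a / x) * t) powr (- (2 * \<theta>))
      = x powr (2 * \<theta>) * (t powr \<rho> * D t powr (- 2 * \<theta>))" if "t \<in> {0..1} - {1}" for t
    using that scale[of t] by simp
  have "(LINT t:{0..1}|lebesgue. t powr \<rho> * (1 - t) powr 0 * (1 - (1 - a / x) * t) powr (- (2 * \<theta>)))
      = integral {0..1} (\<lambda>t. t powr \<rho> * (1 - t) powr 0 * (1 - (1 - a / x) * t) powr (- (2 * \<theta>)))"
    by (intro set_lebesgue_integral_eq_integral absolutely_integrable_spike[OF AI, of "{1}"] eq) auto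
  also have "\<dots> = integral {0..1} (\<lambda>t. x powr (2 * \<theta>) * (t powr \<rho> * D t powr (- 2 * \<theta>)))"
    by (rule integral_spike[of "{1}"]) (simp, rule eq[symmetric])
  finally have "(LINT t:{0..1}|lebesgue. t powr \<rho> * (1 - t) powr 0 * (1 - (1 - a / x) * t) powr (- (2 * \<theta>)))
      = x powr (2 * \<theta>) * integral {0..1} (\<lambda>t. t powr \<rho> * D t powr (- 2 * \<theta>))" by simp
  moreover have "Beta (\<rho> + 1) 1 \<noteq> 0"
    unfolding Beta_def using assms(3)
    by (intro less_imp_neq[symmetric] divide_pos_pos mult_pos_pos Gamma_real_pos) auto
  \<comment> \<open>Removing \<open>powr_zero_eq_one\<close> keeps \<open>(1 - t) powr 0\<close> in
    the shape in which the integral was computed.\<close>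
  ultimately show ?thesis using assms by (simp add: lambda1_def hyp2F1_def D_def del: powr_zero_eq_one)
qed

text \<open>Here \<open>B = 1\<close>, so the weight of exponent \<rho> sits on
  \<open>1 - t\<close>. Reflection moves it to \<open>t\<close>, since
  \<open>1 - (1 - x / b) * t = D (1 - t) / b\<close>.\<close>

lemma lambda3_eq_integral:
  assumes "0 < b" "0 < x" "\<rho> > 0"
  shows "lambda3 b x 0 \<theta> \<rho> = integral {0..1} (\<lambda>t. t powr \<rho> * (t * b + (1 - t) * x) powr (- 2 * \<theta>))"
proof -
  define D where "D t = t * b + (1 - t) * x" for t
  have D: "D t > 0" if "t \<in> {0..1}" for t
    unfolding D_def using assms(1,2) that by (rule convex_combination_pos)
  define G where "G t = b powr (2 * \<theta>) * (t powr \<rho> * D t powr (- 2 * \<theta>))" for t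
  have scale: "(1 - (1 - x / b) * t) powr (- (2 * \<theta>)) = b powr (2 * \<theta>) * D (1 - t) powr (- 2 * \<theta>)"
    if "t \<in> {0..1}" for t
  proof -
    have "1 - (1 - x / b) * t = D (1 - t) / b" using assms by (simp add: D_def field_simps)
    then show ?thesis using D[of "1 - t"] that assms by (simp add: powr_divide powr_minus_divide)
  qed
  have "(\<lambda>t. t powr \<rho> * D t powr (- 2 * \<theta>)) absolutely_integrable_on {0..1}"
    unfolding D_def using assms by (intro absolutely_integrable_powr_mult_affine_powr) auto
  then have AI: "G absolutely_integrable_on {0..1}"
    unfolding G_def by (intro set_integrable_mult_right)
  note refl = absolutely_integrable_integral_reflect_unit[OF AI]
  \<comment> \<open>The zero exponent is now on \<open>t\<close>, so the exceptional point is
    \<open>t = 0\<close>.\<close>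
  have eq: "t powr 0 * (1 - t) powr \<rho> * (1 - (1 - x / b) * t) powr (- (2 * \<theta>)) = G (1 - t)"
    if "t \<in> {0..1} - {0}" for t
    using that scale[of t] by (simp add: G_def)
  have "(LINT t:{0..1}|lebesgue. t powr 0 * (1 - t) powr \<rho> * (1 - (1 - x / b) * t) powr (- (2 * \<theta>)))
      = integral {0..1} (\<lambda>t. t powr 0 * (1 - t) powr \<rho> * (1 - (1 - x / b) * t) powr (- (2 * \<theta>)))"
    by (intro set_lebesgue_integral_eq_integral absolutely_integrable_spike[OF refl(1), of "{0}"] eq) auto
  also have "\<dots> = integral {0..1} (\<lambda>t. G (1 - t))"
    by (rule integral_spike[of "{0}"]) (simp, rule eq[symmetric])
  also have "\<dots> = integral {0..1} G" by (rule refl(2))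
  also have "\<dots> = b powr (2 * \<theta>) * integral {0..1} (\<lambda>t. t powr \<rho> * D t powr (- 2 * \<theta>))"
    by (simp add: G_def[abs_def])
  finally have "(LINT t:{0..1}|lebesgue. t powr 0 * (1 - t) powr \<rho> * (1 - (1 - x / b) * t) powr (- (2 * \<theta>)))
      = b powr (2 * \<theta>) * integral {0..1} (\<lambda>t. t powr \<rho> * D t powr (- 2 * \<theta>))" .
  moreover have "Beta 1 (\<rho> + 1) \<noteq> 0"
    unfolding Beta_def using assms(3)
    by (intro less_imp_neq[symmetric] divide_pos_pos mult_pos_pos Gamma_real_pos) auto
  ultimately show ?thesis using assms by (simp add: lambda3_def hyp2F1_def D_def add.commute[of 1 \<rho>] del: powr_zero_eq_one)
qed

section \<open>Integration by parts along the harmonic path\<close>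

text \<open>The point \<open>c\<close> may lie on either side of \<open>x\<close>, so that both
  halves of the theorem are instances.\<close>

lemma one_sided_Ostrowski_bound:
  fixes f f' :: "real \<Rightarrow> real"
  assumes K: "c \<in> K" "x \<in> K" and pos: "c > 0" "x > 0"
    and der: "\<And>u. u \<in> K \<Longrightarrow> (f has_real_derivative f' u) (at u within K)"
    and \<alpha>: "\<alpha> > 0" and s: "s > 0" and pq: "p > 1" "q > 1" "1 / p + 1 / q = 1"
    and conv: "harm_s_convex_on s K (\<lambda>u. \<bar>f' u\<bar> powr q)"
  shows "\<bar>f x - \<alpha> * integral {0..1} (\<lambda>t. t powr (\<alpha> - 1) * f (c * x / (t * c + (1 - t) * x)))\<bar>
    \<le> \<bar>x - c\<bar> * (c * x)
      * integral {0..1} (\<lambda>t. t powr (\<alpha> * p) * (t * c + (1 - t) * x) powr (- 2 * p)) powr (1 / p)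
      * ((\<bar>f' x\<bar> powr q + \<bar>f' c\<bar> powr q) / (s + 1)) powr (1 / q)"
proof -
  define D where "D t = t * c + (1 - t) * x" for t
  define y where "y t = c * x / D t" for t
  define G where "G t = t powr \<alpha> * f (y t)" for t
  define y' where "y' t = (x - c) * (c * x) / (D t)\<^sup>2" for t
  have D: "D t > 0" if "t \<in> {0..1}" for t
    unfolding D_def using pos that by (rule convex_combination_pos)
  have yK: "y t \<in> K" if "t \<in> {0..1}" for t
  proof -
    \<comment> \<open>\<open>D t\<close> is a weighted mean, hence between \<open>min c x\<close>
      and \<open>max c x\<close>. Dividing their product \<open>c * x\<close> by such a number stays
      between them; the lower bound on \<open>D t\<close> comes from negating the upper one.\<close>
    have "D t \<le> max c x"
      using convex_bound_le[of c "max c x" x t "1 - t"] that by (simp add: D_def)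
    moreover have "min c x \<le> D t"
      using convex_bound_le[of "- c" "- min c x" "- x" t "1 - t"] that by (simp add: D_def)
    moreover have "c * x = min c x * max c x" by (simp add: min_def max_def)
    moreover have "min c x > 0" "max c x > 0" using pos by auto
    ultimately have "min c x \<le> y t" "y t \<le> max c x"
      using D[OF that] by (simp_all add: y_def divide_le_eq le_divide_eq mult.commute mult_right_mono)
    moreover have "is_interval K" using conv by (simp add: harm_s_convex_on_def)
    moreover have "min c x \<in> K" "max c x \<in> K" using K by (auto simp: min_def max_def)
    ultimately show ?thesis by (blast intro: mem_is_interval_1_I)
  qed
  have dery: "(y has_real_derivative y' t) (at t within {0..1})" if "t \<in> {0..1}" for t
    using D[OF that] unfolding y_def[abs_def] y'_def D_def
    by (auto intro!: derivative_eq_intros simp: power2_eq_square field_simps)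
  have derfy: "((\<lambda>t. f (y t)) has_real_derivative f' (y t) * y' t) (at t within {0..1})"
    if "t \<in> {0..1}" for t
    using DERIV_image_chain[OF DERIV_subset[OF der[OF yK[OF that]]] dery[OF that]] yK
    by (simp add: o_def image_subset_iff)
  have contfy: "continuous_on {0..1} (\<lambda>t. f (y t))"
    using derfy by (rule DERIV_continuous_on)
  have contG: "continuous_on {0..1} G"
    unfolding G_def using \<alpha> by (intro continuous_on_mult continuous_on_powr' contfy) (auto intro!: continuous_intros)
  \<comment> \<open>Interior points only: for \<open>\<alpha> < 1\<close> the factor
    \<open>t powr \<alpha>\<close> is not differentiable at 0. Continuity of \<open>G\<close> covers
    the endpoints.\<close>
  have derG: "(G has_vector_derivative \<alpha> * (t powr (\<alpha> - 1) * f (y t)) + t powr \<alpha> * (f' (y t) * y' t)) (at t)"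
    if t: "t \<in> {0<..<1}" for t
  proof -
    have "((\<lambda>t. f (y t)) has_real_derivative f' (y t) * y' t) (at t)"
      using derfy[of t] t at_within_Icc_at[of 0 t 1] by auto
    then show ?thesis
      unfolding G_def has_real_derivative_iff_has_vector_derivative[symmetric] using t
      by (auto intro!: derivative_eq_intros)
  qed
  \<comment> \<open>\<open>G 1 = f x\<close> because \<open>y 1 = x\<close>, and
    \<open>G 0 = 0\<close> because \<open>0 powr \<alpha> = 0\<close>.\<close>
  have FTC: "((\<lambda>t. \<alpha> * (t powr (\<alpha> - 1) * f (y t)) + t powr \<alpha> * (f' (y t) * y' t)) has_integral f x) {0..1}"
    using fundamental_theorem_of_calculus_interior[OF zero_le_one contG derG] \<alpha> pos
    by (simp add: G_def y_def D_def)
  have "(\<lambda>t. t powr (\<alpha> - 1) * f (y t)) integrable_on {0..1}"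
    using absolutely_integrable_powr_mult_continuous[OF _ contfy, of "\<alpha> - 1"] \<alpha>
    by (simp add: set_lebesgue_integral_eq_integral)
  then have "((\<lambda>t. \<alpha> * (t powr (\<alpha> - 1) * f (y t))) has_integral
      \<alpha> * integral {0..1} (\<lambda>t. t powr (\<alpha> - 1) * f (y t))) {0..1}"
    by (intro has_integral_mult_right integrable_integral)
  \<comment> \<open>Subtracting the integrable part makes the remainder integrable, with no separate
    argument about \<open>f'\<close>.\<close>
  from has_integral_diff[OF FTC this]
  have rem: "((\<lambda>t. t powr \<alpha> * (f' (y t) * y' t)) has_integral
      f x - \<alpha> * integral {0..1} (\<lambda>t. t powr (\<alpha> - 1) * f (y t))) {0..1}" by simp
  define k where "k = (x - c) * (c * x)"
  define F where "F t = t powr \<alpha> * (f' (y t) / (D t)\<^sup>2)" for t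
  define u where "u t = t powr \<alpha> * D t powr (- 2)" for t
  define w where "w t = t powr s * \<bar>f' x\<bar> powr q + (1 - t) powr s * \<bar>f' c\<bar> powr q" for t
  \<comment> \<open>\<open>F\<close> is the remainder divided by \<open>k\<close>, which vanishes
    exactly for \<open>c = x\<close>. In that case both sides of the claim are 0.\<close>
  have F: "F integrable_on {0..1}" if "c \<noteq> x"
    using integrable_on_cmult_right[OF has_integral_integrable[OF rem], of "1 / k"] that pos
    by (simp add: F_def[abs_def] y'_def k_def)
  have FI: "f x - \<alpha> * integral {0..1} (\<lambda>t. t powr (\<alpha> - 1) * f (y t)) = k * integral {0..1} F"
  proof -
    have "(\<lambda>t. t powr \<alpha> * (f' (y t) * y' t)) = (\<lambda>t. k * F t)"
      by (auto simp: F_def y'_def k_def)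
    then show ?thesis using integral_unique[OF rem] by simp
  qed
  have u_powr: "u t powr p = t powr (\<alpha> * p) * D t powr (- 2 * p)" for t
    by (simp add: u_def powr_mult powr_powr)
  have u: "(\<lambda>t. u t powr p) integrable_on {0..1}"
    unfolding u_powr D_def using pos \<alpha> pq
    by (intro set_lebesgue_integral_eq_integral absolutely_integrable_powr_mult_affine_powr)
      (auto intro: less_trans[of _ 0])
  have powr_s: "((\<lambda>t. t powr s) has_integral (1 / (s + 1))) {0..1}"
    using has_integral_powr_from_0[of s 1] s by simp
  then have "(\<lambda>t. t powr s) absolutely_integrable_on {0..1::real}"
    by (intro nonnegative_absolutely_integrable_1) auto
  from absolutely_integrable_integral_reflect_unit[OF this]
  have powr_s': "((\<lambda>t. (1 - t) powr s) has_integral (1 / (s + 1))) {0..1}"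
    using integral_unique[OF powr_s] by (metis has_integral_integral set_lebesgue_integral_eq_integral(1))
  have w: "(w has_integral (\<bar>f' x\<bar> powr q + \<bar>f' c\<bar> powr q) / (s + 1)) {0..1}"
    using has_integral_add[OF has_integral_mult_left[OF powr_s, of "\<bar>f' x\<bar> powr q"]
        has_integral_mult_left[OF powr_s', of "\<bar>f' c\<bar> powr q"]]
    by (simp add: w_def[abs_def] add_divide_distrib)
  \<comment> \<open>The definition of harmonic convexity at \<open>u = c\<close>,
    \<open>v = x\<close>; its argument is exactly \<open>y t\<close>.\<close>
  have vw: "\<bar>f' (y t)\<bar> powr q \<le> w t" if "t \<in> {0..1}" for t
    using conv K that by (simp add: harm_s_convex_on_def w_def y_def D_def)
  show ?thesis
  proof (cases "c = x")
    case True
    then show ?thesis using FI pos by (simp add: y_def D_def k_def)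
  next
    case False
    have "\<bar>integral {0..1} F\<bar> \<le> integral {0..1} (\<lambda>t. u t powr p) powr (1 / p) * integral {0..1} w powr (1 / q)"
      using D by (intro Holder_integral_bound[OF pq F[OF False] u _ has_integral_integrable[OF w] _ vw])
        (auto simp: u_def F_def abs_mult powr_minus power2_eq_square powr_numeral field_simps less_imp_le)
    then have "\<bar>k\<bar> * \<bar>integral {0..1} F\<bar> \<le> \<bar>k\<bar> * (integral {0..1} (\<lambda>t. u t powr p) powr (1 / p)
        * ((\<bar>f' x\<bar> powr q + \<bar>f' c\<bar> powr q) / (s + 1)) powr (1 / q))"
      unfolding integral_unique[OF w] by (rule mult_left_mono) simp
    moreover have "\<bar>k\<bar> = \<bar>x - c\<bar> * (c * x)" using pos by (simp add: k_def abs_mult)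
    ultimately show ?thesis
      using FI unfolding u_powr by (simp add: abs_mult y_def D_def mult_ac)
  qed
qed

section \<open>Return to the fractional integrals\<close>

text \<open>This is the previous bound multiplied by
  \<open>\<bar>1 / x - 1 / c\<bar> powr \<alpha>\<close>, the factor produced by rescaling the
  kernel.\<close>

lemma RL_remainder_bound:
  fixes f f' :: "real \<Rightarrow> real"
  assumes K: "c \<in> K" "x \<in> K" "closed_segment c x \<subseteq> K" and pos: "c > 0" "x > 0"
    and der: "\<And>u. u \<in> K \<Longrightarrow> (f has_real_derivative f' u) (at u within K)"
    and \<alpha>: "\<alpha> > 0" and s: "s > 0" and pq: "p > 1" "q > 1" "1 / p + 1 / q = 1"
    and conv: "harm_s_convex_on s K (\<lambda>u. \<bar>f' u\<bar> powr q)"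
  shows "\<bar>(\<bar>x - c\<bar> / (c * x)) powr \<alpha> * f x
      - \<alpha> * (LINT t:closed_segment (1 / x) (1 / c)|lebesgue. \<bar>1 / c - t\<bar> powr (\<alpha> - 1) * f (1 / t))\<bar>
    \<le> \<bar>x - c\<bar> powr (\<alpha> + 1) / (c * x) powr (\<alpha> - 1)
      * integral {0..1} (\<lambda>t. t powr (\<alpha> * p) * (t * c + (1 - t) * x) powr (- 2 * p)) powr (1 / p)
      * ((\<bar>f' x\<bar> powr q + \<bar>f' c\<bar> powr q) / (s + 1)) powr (1 / q)"
proof (cases "c = x")
  case True
  \<comment> \<open>At the only point of the degenerate segment the kernel is
    \<open>0 powr (\<alpha> - 1) = 0\<close>.\<close>
  have "(LINT t:{1 / x}|lebesgue. \<bar>1 / x - t\<bar> powr (\<alpha> - 1) * f (1 / t)) = (LINT t:{1 / x}|lebesgue. 0)"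
    by (intro set_lebesgue_integral_cong) auto
  then show ?thesis using True by simp
next
  case False
  define J where "J = integral {0..1} (\<lambda>t. t powr (\<alpha> - 1) * f (c * x / (t * c + (1 - t) * x)))"
  have img: "1 / t \<in> closed_segment c x" if "t \<in> closed_segment (1 / x) (1 / c)" for t
  proof -
    have t: "min (1 / x) (1 / c) \<le> t" "t \<le> max (1 / x) (1 / c)"
      using that by (auto simp: closed_segment_eq_real_ivl split: if_splits)
    then have "t > 0" using pos by (smt (verit) zero_less_divide_1_iff)
    then show ?thesis
      using t pos by (auto simp: closed_segment_eq_real_ivl divide_simps mult.commute min_def max_def split: if_splits)
  qed
  have nz: "t \<noteq> 0" if "t \<in> closed_segment (1 / x) (1 / c)" for t
    using img[OF that] pos by (auto simp: closed_segment_eq_real_ivl split: if_splits)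
  have "continuous_on K f" using der by (rule DERIV_continuous_on)
  then have cont: "continuous_on (closed_segment (1 / x) (1 / c)) (\<lambda>t. f (1 / t))"
  proof (rule continuous_on_compose2)
    show "continuous_on (closed_segment (1 / x) (1 / c)) (\<lambda>t. 1 / t)"
      using nz by (intro continuous_on_divide continuous_on_const continuous_on_id) blast
    show "(\<lambda>t. 1 / t) ` closed_segment (1 / x) (1 / c) \<subseteq> K" using img K(3) by blast
  qed
  have d: "\<bar>1 / x - 1 / c\<bar> = \<bar>x - c\<bar> / (c * x)"
    using pos by (simp add: divide_simps abs_if)
  \<comment> \<open>The affine path between the reciprocals is \<open>1 / y(t)\<close>, so
    \<open>f (1 / t)\<close> turns into \<open>f\<close> along the harmonic path.\<close>
  have arg: "1 / (1 / c + t * (1 / x - 1 / c)) = c * x / (t * c + (1 - t) * x)" for t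
    using pos by (simp add: divide_simps) (auto simp: algebra_simps)
  have L: "(LINT t:closed_segment (1 / x) (1 / c)|lebesgue. \<bar>1 / c - t\<bar> powr (\<alpha> - 1) * f (1 / t))
      = (\<bar>x - c\<bar> / (c * x)) powr \<alpha> * J"
    using RL_kernel_integral[OF _ \<alpha> cont] False unfolding d arg J_def by simp
  have coeff: "(\<bar>x - c\<bar> / (c * x)) powr \<alpha> * (\<bar>x - c\<bar> * (c * x))
      = \<bar>x - c\<bar> powr (\<alpha> + 1) / (c * x) powr (\<alpha> - 1)"
    using pos False by (simp add: powr_divide powr_add powr_diff)
  have "(\<bar>x - c\<bar> / (c * x)) powr \<alpha> * \<bar>f x - \<alpha> * J\<bar>
      \<le> (\<bar>x - c\<bar> / (c * x)) powr \<alpha> * (\<bar>x - c\<bar> * (c * x)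
      * integral {0..1} (\<lambda>t. t powr (\<alpha> * p) * (t * c + (1 - t) * x) powr (- 2 * p)) powr (1 / p)
      * ((\<bar>f' x\<bar> powr q + \<bar>f' c\<bar> powr q) / (s + 1)) powr (1 / q))"
    unfolding J_def
    by (intro mult_left_mono one_sided_Ostrowski_bound[OF K(1,2) pos der \<alpha> s pq conv]) auto
  moreover have "(\<bar>x - c\<bar> / (c * x)) powr \<alpha> * \<bar>f x - \<alpha> * J\<bar>
      = \<bar>(\<bar>x - c\<bar> / (c * x)) powr \<alpha> * f x - \<alpha> * ((\<bar>x - c\<bar> / (c * x)) powr \<alpha> * J)\<bar>"
    by (simp add: abs_mult flip: right_diff_distrib mult.left_commute[of _ \<alpha>])
  ultimately show ?thesis unfolding L coeff[symmetric] by (simp only: mult.assoc)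
qed

section \<open>Assembly of the two halves\<close>

theorem theorem12:
  fixes I :: "real set" and f f' :: "real \<Rightarrow> real" and a b \<alpha> s p q :: real
  assumes "is_interval I" and "I \<subseteq> {0<..}"
    and "\<And>u. u \<in> interior I \<Longrightarrow> (f has_real_derivative f' u) (at u)"
    and "a \<in> I" and "b \<in> I" and "a < b"
    and "(f has_real_derivative f' a) (at a within I)"
    and "(f has_real_derivative f' b) (at b within I)"
    and "f' absolutely_integrable_on {a..b}"
    and "\<alpha> > 0" and "0 < s" and "s \<le> 1" and "q > 1" and "1 / p + 1 / q = 1"
    and "harm_s_convex_on s {a..b} (\<lambda>u. \<bar>f' u\<bar> powr q)"
  shows "\<forall>x\<in>{a..b}.
    \<bar>ostrowski_S f (\<lambda>u. 1 / u) \<alpha> x a b\<bar>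
    \<le> (x - a) powr (\<alpha> + 1) / (a * x) powr (\<alpha> - 1)
        * (lambda1 a x 0 p (\<alpha> * p)) powr (1 / p)
        * ((\<bar>f' x\<bar> powr q + \<bar>f' a\<bar> powr q) / (s + 1)) powr (1 / q)
      + (b - x) powr (\<alpha> + 1) / (b * x) powr (\<alpha> - 1)
        * (lambda3 b x 0 p (\<alpha> * p)) powr (1 / p)
        * ((\<bar>f' x\<bar> powr q + \<bar>f' b\<bar> powr q) / (s + 1)) powr (1 / q)"
proof
  fix x assume x: "x \<in> {a..b}"
  have pos: "a > 0" "b > 0" "x > 0" using assms(2,4,5) x by auto
  have sub: "{a..b} \<subseteq> I"
    using assms(1,4,5) by (meson atLeastAtMost_iff mem_is_interval_1_I subsetI)
  \<comment> \<open>Interior points and the two endpoints are merged into one notion, the derivative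
    relative to \<open>{a..b}\<close>, which plays the role of \<open>K\<close> in
    \<open>RL_remainder_bound\<close>.\<close>
  have der: "(f has_real_derivative f' u) (at u within {a..b})" if "u \<in> {a..b}" for u
  proof -
    have "u = a \<or> u = b \<or> u \<in> {a<..<b}" using that by auto
    then consider "u = a" | "u = b" | "u \<in> {a<..<b}" by blast
    then show ?thesis
    proof cases
      case 3
      have "{a<..<b} \<subseteq> interior I" using sub by (intro interior_maximal) auto
      then show ?thesis using 3 assms(3) by (blast intro: DERIV_subset)
    qed (use assms(7,8) sub in \<open>blast intro: DERIV_subset\<close>)+
  qed
  have p: "p > 1"
  proof -
    have "1 / p = 1 - 1 / q" using assms(14) by simp
    moreover have "0 < 1 / q" "1 / q < 1" using assms(13) by simp_all
    ultimately have "1 / p > 0" "1 / p < 1" by linarith+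
    then show ?thesis by (simp add: divide_less_eq split: if_splits)
  qed
  have \<alpha>p: "\<alpha> * p > 0" using p assms(10) by simp
  note bound = RL_remainder_bound[OF _ x _ _ pos(3) der assms(10,11) p assms(13,14,15)]
  define P where "P = (LINT t:{1 / x..1 / a}|lebesgue. (1 / a - t) powr (\<alpha> - 1) * f (1 / t))"
  define M where "M = (LINT t:{1 / b..1 / x}|lebesgue. (t - 1 / b) powr (\<alpha> - 1) * f (1 / t))"
  \<comment> \<open>Reciprocals reverse the order: the side of \<open>a\<close> belongs to
    \<open>RL_plus\<close>, the side of \<open>b\<close> to \<open>RL_minus\<close>.\<close>
  have segs: "closed_segment (1 / x) (1 / a) = {1 / x..1 / a}" "closed_segment (1 / x) (1 / b) = {1 / b..1 / x}"
    using x pos closed_segment_eq_real_ivl1[of "1 / b" "1 / x"] closed_segment_eq_real_ivl1[of "1 / x" "1 / a"]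
    by (simp_all add: frac_le closed_segment_commute[of "1 / x" "1 / b"])
  have P: "(LINT t:closed_segment (1 / x) (1 / a)|lebesgue. \<bar>1 / a - t\<bar> powr (\<alpha> - 1) * f (1 / t)) = P"
    unfolding segs P_def by (intro set_lebesgue_integral_cong) auto
  have M: "(LINT t:closed_segment (1 / x) (1 / b)|lebesgue. \<bar>1 / b - t\<bar> powr (\<alpha> - 1) * f (1 / t)) = M"
    unfolding segs M_def by (intro set_lebesgue_integral_cong) auto
  have "\<alpha> \<notin> \<int>\<^sub>\<le>\<^sub>0" using assms(10) by (auto elim: nonpos_Ints_cases)
  \<comment> \<open>The quotient of the two Gamma values is the factor \<alpha> that differentiating
    \<open>t powr \<alpha>\<close> produced.\<close>
  then have Gam: "Gamma (\<alpha> + 1) * (1 / Gamma \<alpha> * z) = \<alpha> * z" for z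
    using Gamma_real_pos[OF assms(10)] by (simp add: Gamma_plus1)
  have "ostrowski_S f (\<lambda>u. 1 / u) \<alpha> x a b
      = (((x - a) / (a * x)) powr \<alpha> + ((b - x) / (b * x)) powr \<alpha>) * f x - \<alpha> * (M + P)"
    by (simp only: ostrowski_S_def RL_plus_def RL_minus_def P_def M_def o_def distrib_left[of "Gamma _"] Gam
        distrib_left[of \<alpha>])
  then have "ostrowski_S f (\<lambda>u. 1 / u) \<alpha> x a b
      = (((x - a) / (a * x)) powr \<alpha> * f x - \<alpha> * P) + (((b - x) / (b * x)) powr \<alpha> * f x - \<alpha> * M)"
    by (simp only: distrib_left distrib_right)
  moreover have "\<bar>((x - a) / (a * x)) powr \<alpha> * f x - \<alpha> * P\<bar>
      \<le> (x - a) powr (\<alpha> + 1) / (a * x) powr (\<alpha> - 1)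
        * (lambda1 a x 0 p (\<alpha> * p)) powr (1 / p)
        * ((\<bar>f' x\<bar> powr q + \<bar>f' a\<bar> powr q) / (s + 1)) powr (1 / q)"
    using bound[of a] x pos(1) assms(6) unfolding P
    by (simp add: lambda1_eq_integral[OF pos(1,3) \<alpha>p] closed_segment_eq_real_ivl)
  moreover have "\<bar>((b - x) / (b * x)) powr \<alpha> * f x - \<alpha> * M\<bar>
      \<le> (b - x) powr (\<alpha> + 1) / (b * x) powr (\<alpha> - 1)
        * (lambda3 b x 0 p (\<alpha> * p)) powr (1 / p)
        * ((\<bar>f' x\<bar> powr q + \<bar>f' b\<bar> powr q) / (s + 1)) powr (1 / q)"
    using bound[of b] x pos(2) assms(6) unfolding M
    by (simp add: lambda3_eq_integral[OF pos(2,3) \<alpha>p] closed_segment_eq_real_ivl abs_minus_commute[of x])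
  ultimately show "\<bar>ostrowski_S f (\<lambda>u. 1 / u) \<alpha> x a b\<bar>
    \<le> (x - a) powr (\<alpha> + 1) / (a * x) powr (\<alpha> - 1)
        * (lambda1 a x 0 p (\<alpha> * p)) powr (1 / p)
        * ((\<bar>f' x\<bar> powr q + \<bar>f' a\<bar> powr q) / (s + 1)) powr (1 / q)
      + (b - x) powr (\<alpha> + 1) / (b * x) powr (\<alpha> - 1)
        * (lambda3 b x 0 p (\<alpha> * p)) powr (1 / p)
        * ((\<bar>f' x\<bar> powr q + \<bar>f' b\<bar> powr q) / (s + 1)) powr (1 / q)"
    by linarith
qed

end
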